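(* Let $r\in\mathbb{N}$, $n\in\mathbb{Z}_+$ and $x\in\mathbb{Z}_p$. Define $$E_{n,w,q}^{(r-1,r)}(x)=\int_{\mathbb{Z}_p^r} w^{x_1+\cdots+x_r}[x+x_1+\cdots+x_r]_q^n\,q^{\sum_{i=1}^{r}(r-i)x_i}\,d\mu_{-1}(x_1)\cdots d\mu_{-1}(x_r).$$ Then $$E_{n,w,q}^{(r-1,r)}(x)=\frac{2^r}{(1-q)^n}\sum_{l=0}^{n}\frac{\binom{n}{l}(-1)^l q^{lx}}{(-q^{l}w:q)_r}=2^r\sum_{m=0}^{\infty}\binom{m+r-1}{m}_{q}(-1)^m w^m[m+x]_q^n.$$
   Context: Let $p$ be a fixed odd prime, $\mathbb{Z}_p$ the ring of $p$-adic integers, $\mathbb{C}_p$ the completion of the algebraic closure of $\mathbb{Q}_p$, and $\mathbb{Z}_+=\mathbb{N}\cup\{0\}$. Let $q,w\in\mathbb{C}_p$ with $|1-q|_p<1$ and $|1-w|_p<1$. For $x\in\mathbb{Z}_p$ put $[x]_q=\frac{1-q^x}{1-q}$; $[k]_q!=[k]_q\cdots[1]_q$; $\binom{n}{k}_q=\frac{[n]_q[n-1]_q\cdots[n-k+1]_q}{[k]_q!}$; $(a:q)_r=\prod_{j=0}^{r-1}(1-aq^j)$. For a uniformly differentiable function $f:\mathbb{Z}_p\to\mathbb{C}_p$, the fermionic $p$-adic integral is $\int_{\mathbb{Z}_p}f(x)\,d\mu_{-1}(x)=\lim_{N\to\infty}\sum_{x=0}^{p^N-1}f(x)(-1)^x$,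 and $\int_{\mathbb{Z}_p^r}$ denotes the $r$-fold iterated fermionic integral.
   Formalization: Since |w|=1, the last series diverges p-adically (e.g. r=1, n=0, w=1), so it is read as the value at w of the rational function with that power series in w; this equality also assumes all [k]_q! are nonzero, so the q-binomials are defined, and q≠1 is assumed throughout. *)

theory Defs
  imports
    "HOL-Analysis.Elementary_Metric_Spaces"
    "HOL-Computational_Algebra.Polynomial_FPS"
    "HOL-Computational_Algebra.Primes"
begin

subsection \<open>The field of p-adic complex numbers\<close>

class complete_nonarch_field = field_char_0 + complete_space +
  fixes vabs :: "'a \<Rightarrow> real"
  assumes dist_vabs: "dist x y = vabs (x - y)"
    and vabs_mult: "vabs (x * y) = vabs x * vabs y"
    and vabs_add_le_max: "vabs (x + y) \<le> max (vabs x) (vabs y)"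

text \<open>
  Completions are described inside an ambient complete field: if \<open>vabs p = 1 / p\<close>, then the
  absolute value restricts to the p-adic one on \<open>\<rat>\<close>, so the topological closure of \<open>\<rat>\<close> is its
  p-adic completion.
\<close>

definition Qp :: "'a::complete_nonarch_field set" where
  "Qp = closure \<rat>"

definition Zp :: "'a::complete_nonarch_field set" where
  "Zp = {x \<in> Qp. vabs x \<le> 1}"

definition Qp_bar :: "'a::complete_nonarch_field set" where
  "Qp_bar = {a. \<exists>P. P \<noteq> 0 \<and> (\<forall>i. coeff P i \<in> Qp) \<and> poly P a = 0}"

text \<open>
  The type \<open>'a\<close> (complete by its class) is the completion of an algebraic closure of the p-adic
  numbers; this determines it up to isometric isomorphism.
\<close>

definition is_Cp :: "nat \<Rightarrow> 'a::complete_nonarch_field itself \<Rightarrow> bool" where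
  "is_Cp p _ \<longleftrightarrow>
     vabs (of_nat p :: 'a) = 1 / real p \<and>
     (\<forall>P :: 'a poly. (\<forall>i. coeff P i \<in> Qp_bar) \<and> degree P > 0 \<longrightarrow> (\<exists>a\<in>Qp_bar. poly P a = 0)) \<and>
     closure (Qp_bar :: 'a set) = UNIV"


subsection \<open>q-analogues\<close>

text \<open>
  For \<open>vabs (1 - q) < 1\<close> the map \<open>n \<mapsto> q ^ n\<close> on the natural numbers is uniformly continuous for the
  p-adic metric; \<open>q\<^sup>x\<close> is its continuous extension to \<open>x \<in> Zp\<close>, where the naturals are dense.
\<close>

definition padic_pow :: "'a::complete_nonarch_field \<Rightarrow> 'a \<Rightarrow> 'a" where
  "padic_pow q x = Lim (filtercomap (of_nat :: nat \<Rightarrow> 'a) (nhds x)) (\<lambda>n. q ^ n)"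

definition qnum :: "'a::complete_nonarch_field \<Rightarrow> 'a \<Rightarrow> 'a" where
  "qnum q x = (1 - padic_pow q x) / (1 - q)"

definition qfact :: "'a::complete_nonarch_field \<Rightarrow> nat \<Rightarrow> 'a" where
  "qfact q k = (\<Prod>j=1..k. qnum q (of_nat j))"

definition qbinom :: "'a::complete_nonarch_field \<Rightarrow> nat \<Rightarrow> nat \<Rightarrow> 'a" where
  "qbinom q n k = (\<Prod>j<k. qnum q (of_nat n - of_nat j)) / qfact q k"

definition qpoch :: "'a::complete_nonarch_field \<Rightarrow> 'a \<Rightarrow> nat \<Rightarrow> 'a" where
  "qpoch a q r = (\<Prod>j<r. 1 - a * q ^ j)"


subsection \<open>Fermionic p-adic integrals\<close>

definition fermionic_integral ::
    "nat \<Rightarrow> ('a::complete_nonarch_field \<Rightarrow> 'a) \<Rightarrow> 'a" where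
  "fermionic_integral p f = lim (\<lambda>N. \<Sum>x<p ^ N. f (of_nat x) * (-1) ^ x)"

text \<open>
  The integrand is a function of a vector of which only the components \<open>1, \<dots>, r\<close> matter; the
  variable with index 1 is integrated innermost.
\<close>

primrec fermionic_integral_iter ::
    "nat \<Rightarrow> nat \<Rightarrow> ((nat \<Rightarrow> 'a::complete_nonarch_field) \<Rightarrow> 'a) \<Rightarrow> 'a" where
  "fermionic_integral_iter p 0 f = f (\<lambda>_. 0)"
| "fermionic_integral_iter p (Suc r) f =
     fermionic_integral p (\<lambda>t. fermionic_integral_iter p r (\<lambda>x. f (x(Suc r := t))))"

definition twisted_qEuler ::
    "nat \<Rightarrow> nat \<Rightarrow> nat \<Rightarrow> 'a::complete_nonarch_field \<Rightarrow> 'a \<Rightarrow> 'a \<Rightarrow> 'a" where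
  "twisted_qEuler p r n w q x =
     fermionic_integral_iter p r (\<lambda>y.
       padic_pow w (\<Sum>i=1..r. y i) * qnum q (x + (\<Sum>i=1..r. y i)) ^ n *
       padic_pow q (\<Sum>i=1..r. of_nat (r - i) * y i))"


subsection \<open>Values of power series outside the disc of convergence\<close>

text \<open>
  If \<open>vabs (1 - w) < 1\<close> then \<open>vabs w = 1\<close>, and a series \<open>\<Sum>m. c m * w ^ m\<close> whose coefficients do not
  tend to 0 diverges in the p-adic topology (for instance \<open>\<Sum>m. (-1) ^ m * w ^ m\<close>, which stands for
  \<open>1 / (1 + w)\<close>).  Such a series denotes the value at \<open>w\<close> of the rational function whose expansion
  at 0 is \<open>\<Sum>m. c m * X ^ m\<close>.  The lemmas below show that this value is unique and that it is the
  ordinary sum whenever the series converges.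
\<close>

definition power_series_sums :: "(nat \<Rightarrow> 'a::field) \<Rightarrow> 'a \<Rightarrow> 'a \<Rightarrow> bool" where
  "power_series_sums c w S \<longleftrightarrow>
     (\<exists>P Q. poly Q 0 \<noteq> 0 \<and> poly Q w \<noteq> 0 \<and>
        Abs_fps c = fps_of_poly P / fps_of_poly Q \<and> S = poly P w / poly Q w)"

definition power_series_summable :: "(nat \<Rightarrow> 'a::field) \<Rightarrow> 'a \<Rightarrow> bool" where
  "power_series_summable c w \<longleftrightarrow> (\<exists>S. power_series_sums c w S)"

definition power_series_sum :: "(nat \<Rightarrow> 'a::field) \<Rightarrow> 'a \<Rightarrow> 'a" where
  "power_series_sum c w = (THE S. power_series_sums c w S)"

lemma fps_of_poly_eq_divide:
  fixes P Q :: "'a::field poly"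
  assumes "poly Q 0 \<noteq> 0" "C = fps_of_poly P / fps_of_poly Q"
  shows "fps_of_poly Q * C = fps_of_poly P"
proof -
  have "fps_nth (fps_of_poly Q) 0 \<noteq> 0"
    using assms(1) by (simp add: poly_0_coeff_0)
  then have "is_unit (fps_of_poly Q)" by simp
  then show ?thesis
    using assms(2) by (simp add: unit_imp_dvd)
qed

lemma power_series_sums_unique:
  assumes "power_series_sums c w S" "power_series_sums c w T"
  shows "S = T"
proof -
  obtain P Q where 1: "poly Q 0 \<noteq> 0" "poly Q w \<noteq> 0" "S = poly P w / poly Q w"
    "fps_of_poly Q * Abs_fps c = fps_of_poly P"
    using assms(1) fps_of_poly_eq_divide unfolding power_series_sums_def by blast
  obtain P' Q' where 2: "poly Q' 0 \<noteq> 0" "poly Q' w \<noteq> 0" "T = poly P' w / poly Q' w"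
    "fps_of_poly Q' * Abs_fps c = fps_of_poly P'"
    using assms(2) fps_of_poly_eq_divide unfolding power_series_sums_def by blast
  have "fps_of_poly (P * Q') = fps_of_poly (P' * Q)"
    unfolding fps_of_poly_mult 1(4)[symmetric] 2(4)[symmetric] by (simp add: mult_ac)
  then have "P * Q' = P' * Q" by (simp add: fps_of_poly_eq_iff)
  then have "poly P w * poly Q' w = poly P' w * poly Q w" by (metis poly_mult)
  then show ?thesis unfolding 1(3) 2(3) using 1(2) 2(2) by (simp add: frac_eq_eq)
qed

lemma power_series_sum_eq: "power_series_sums c w S \<Longrightarrow> power_series_sum c w = S"
  unfolding power_series_sum_def using power_series_sums_unique by blast

lemma vabs_ge_zero: "vabs (x::'a::complete_nonarch_field) \<ge> 0"
  using dist_vabs[of x 0] by (metis diff_zero zero_le_dist)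

lemma tendsto_nonarch_iff:
  "(f \<longlongrightarrow> (l::'a::complete_nonarch_field)) F \<longleftrightarrow> ((\<lambda>x. vabs (f x - l)) \<longlongrightarrow> 0) F"
  by (subst tendsto_dist_iff) (simp add: dist_vabs)

lemma tendsto_add_nonarch:
  fixes a b :: "'a::complete_nonarch_field"
  assumes "(f \<longlongrightarrow> a) F" "(g \<longlongrightarrow> b) F"
  shows "((\<lambda>x. f x + g x) \<longlongrightarrow> a + b) F"
proof -
  have *: "vabs (f x + g x - (a + b)) \<le> vabs (f x - a) + vabs (g x - b)" for x
  proof -
    have "vabs ((f x - a) + (g x - b)) \<le> max (vabs (f x - a)) (vabs (g x - b))"
      by (rule vabs_add_le_max)
    also have "\<dots> \<le> vabs (f x - a) + vabs (g x - b)"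
      by (simp add: vabs_ge_zero)
    finally show ?thesis by (simp add: algebra_simps)
  qed
  have "((\<lambda>x. vabs (f x - a) + vabs (g x - b)) \<longlongrightarrow> 0) F"
    using assms tendsto_add_zero unfolding tendsto_nonarch_iff by blast
  then show ?thesis unfolding tendsto_nonarch_iff
    by (rule tendsto_sandwich[OF always_eventually always_eventually tendsto_const, rotated 2])
       (auto simp: * vabs_ge_zero)
qed

lemma tendsto_mult_left_nonarch:
  fixes a c :: "'a::complete_nonarch_field"
  assumes "(f \<longlongrightarrow> a) F"
  shows "((\<lambda>x. c * f x) \<longlongrightarrow> c * a) F"
proof -
  have "((\<lambda>x. vabs c * vabs (f x - a)) \<longlongrightarrow> 0) F"
    using assms unfolding tendsto_nonarch_iff by (rule tendsto_mult_right_zero)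
  then show ?thesis
    unfolding tendsto_nonarch_iff by (simp add: vabs_mult[symmetric] algebra_simps)
qed

lemma sums_poly_mult_nonarch:
  fixes w S :: "'a::complete_nonarch_field"
  assumes "(\<lambda>m. fps_nth C m * w ^ m) sums S"
  shows "(\<lambda>m. fps_nth (fps_of_poly Q * C) m * w ^ m) sums (poly Q w * S)"
proof (induction Q)
  case 0
  show ?case by (simp add: sums_def)
next
  case (pCons a Q)
  let ?D = "fps_of_poly Q * C"
  have eq: "(\<Sum>m<Suc n. fps_nth (fps_of_poly (pCons a Q) * C) m * w ^ m) =
     a * (\<Sum>m<Suc n. fps_nth C m * w ^ m) + w * (\<Sum>m<n. fps_nth ?D m * w ^ m)" for n
  proof -
    have D: "fps_of_poly (pCons a Q) * C = fps_const a * C + fps_X * ?D"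
      by (simp add: fps_of_poly_pCons algebra_simps)
    have "(\<Sum>m<Suc n. fps_nth (fps_X * E) m * w ^ m) = w * (\<Sum>m<n. fps_nth E m * w ^ m)" for E
      by (subst sum.lessThan_Suc_shift) (simp add: sum_distrib_left mult.left_commute)
    then show ?thesis
      unfolding D by (simp only: fps_add_nth fps_mult_left_const_nth distrib_right sum.distrib
        mult.assoc sum_distrib_left[symmetric])
  qed
  have "(\<lambda>n. \<Sum>m<Suc n. fps_nth C m * w ^ m) \<longlonglongrightarrow> S"
    using assms unfolding sums_def by (rule LIMSEQ_Suc)
  moreover have "(\<lambda>n. \<Sum>m<n. fps_nth ?D m * w ^ m) \<longlonglongrightarrow> poly Q w * S"
    using pCons.IH unfolding sums_def .
  ultimately have "(\<lambda>n. \<Sum>m<Suc n. fps_nth (fps_of_poly (pCons a Q) * C) m * w ^ m)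
      \<longlonglongrightarrow> a * S + w * (poly Q w * S)"
    unfolding eq by (intro tendsto_add_nonarch tendsto_mult_left_nonarch)
  then show ?case
    unfolding sums_def by (subst (asm) filterlim_sequentially_Suc) (simp add: algebra_simps)
qed

lemma power_series_sums_eq_sums:
  fixes w S T :: "'a::complete_nonarch_field"
  assumes "power_series_sums c w S" "(\<lambda>m. c m * w ^ m) sums T"
  shows "S = T"
proof -
  obtain P Q where 1: "poly Q w \<noteq> 0" "S = poly P w / poly Q w"
    "fps_of_poly Q * Abs_fps c = fps_of_poly P"
    using assms(1) fps_of_poly_eq_divide unfolding power_series_sums_def by blast
  have one: "(\<lambda>m. fps_nth 1 m * w ^ m) sums 1"
    using sums_finite[of "{0}" "\<lambda>m. fps_nth 1 m * w ^ m"] by simp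
  have "(\<lambda>m. fps_nth (fps_of_poly P) m * w ^ m) sums (poly Q w * T)"
    using sums_poly_mult_nonarch[of "Abs_fps c" w T Q] assms(2) 1(3) by simp
  moreover have "(\<lambda>m. fps_nth (fps_of_poly P) m * w ^ m) sums poly P w"
    using sums_poly_mult_nonarch[OF one, of P] by simp
  ultimately have "poly Q w * T = poly P w" by (rule sums_unique2)
  then show ?thesis
    unfolding 1(2) using 1(1) by (metis nonzero_mult_div_cancel_left)
qed

end

theory Submission
  imports Defs "HOL-Number_Theory.Cong"
begin

text \<open>
  The integrals only see the integrand at natural numbers, and there, expanding
  \<open>[x + m]\<^sub>q\<^sup>n\<close> by the binomial theorem, it is a finite sum of products of exponentials
  \<open>a ^ t\<close> with \<open>a = w * q ^ (l + r - i)\<close> in the \<open>i\<close>-th variable.  Since \<open>p\<close> is odd, the alternating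
  sum of \<open>a ^ t\<close> over \<open>t < p ^ N\<close> is \<open>(1 + a ^ p ^ N) / (1 + a)\<close>, which tends to \<open>2 / (1 + a)\<close>;
  multiplying these values gives the closed form.  The same expansion splits the power series
  into \<open>n + 1\<close> series that the q-binomial theorem
  \<open>\<Sum>m. qbinom q (m + r - 1) m * z ^ m = 1 / qpoch z q r\<close> identifies as rational functions.
\<close>

section \<open>Non-archimedean absolute values\<close>

lemma vabs_zero [simp]: "vabs (0::'a::complete_nonarch_field) = 0"
  using dist_vabs[of "0::'a" 0] by simp

lemma vabs_eq_0_iff [simp]: "vabs (x::'a::complete_nonarch_field) = 0 \<longleftrightarrow> x = 0"
  using dist_vabs[of x 0] by (metis diff_zero dist_eq_0_iff)

lemma vabs_one [simp]: "vabs (1::'a::complete_nonarch_field) = 1"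
  using vabs_mult[of "1::'a" 1] by simp

lemma vabs_minus_commute: "vabs (x - y) = vabs (y - x)"
  for x y :: "'a::complete_nonarch_field"
  by (metis dist_commute dist_vabs)

lemma vabs_minus [simp]: "vabs (- x) = vabs (x::'a::complete_nonarch_field)"
  using vabs_minus_commute[of 0 x] by simp

lemma vabs_diff_le_max: "vabs (x - y) \<le> max (vabs x) (vabs y)"
  for x y :: "'a::complete_nonarch_field"
  using vabs_add_le_max[of x "- y"] by simp

lemma vabs_power: "vabs (x ^ n) = vabs x ^ n" for x :: "'a::complete_nonarch_field"
  by (induction n) (simp_all add: vabs_mult)

lemma vabs_sum_le:
  fixes f :: "'b \<Rightarrow> 'a::complete_nonarch_field"
  assumes "\<And>i. i \<in> A \<Longrightarrow> vabs (f i) \<le> B" "0 \<le> B"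
  shows "vabs (sum f A) \<le> B"
  using assms
proof (induction A rule: infinite_finite_induct)
  case (insert a A)
  have "vabs (f a + sum f A) \<le> max (vabs (f a)) (vabs (sum f A))"
    by (rule vabs_add_le_max)
  also have "\<dots> \<le> B" using insert by simp
  finally show ?case using insert by simp
qed auto

lemma vabs_of_nat_le: "vabs (of_nat n :: 'a::complete_nonarch_field) \<le> 1"
proof -
  have "vabs (\<Sum>i<n. 1::'a) \<le> 1" by (rule vabs_sum_le) auto
  then show ?thesis by simp
qed

lemma vabs_of_int_le: "vabs (of_int k :: 'a::complete_nonarch_field) \<le> 1"
  by (cases k rule: int_cases2) (simp_all add: vabs_of_nat_le)

text \<open>The isosceles triangle principle: \<open>1\<close> and \<open>1 - q\<close> have
  different sizes, so their difference \<open>q\<close> has the larger one.\<close>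

lemma vabs_eq_1:
  fixes q :: "'a::complete_nonarch_field"
  assumes "vabs (1 - q) < 1"
  shows "vabs q = 1"
proof -
  have "vabs (1 - (1 - q)) \<le> max 1 (vabs (1 - q))"
    using vabs_diff_le_max[of 1 "1 - q"] by simp
  moreover have "1 \<le> max (vabs (1 - q)) (vabs q)"
    using vabs_add_le_max[of "1 - q" q] by simp
  ultimately show ?thesis using assms by simp
qed

text \<open>\<open>y - 1\<close> divides \<open>y ^ n - 1\<close>, and the cofactor, a geometric sum
  of elements of the unit ball, stays in that ball.\<close>

lemma vabs_power_minus_1_le:
  fixes y :: "'a::complete_nonarch_field"
  assumes "vabs y \<le> 1"
  shows "vabs (y ^ n - 1) \<le> vabs (y - 1)"
proof -
  have "vabs (\<Sum>i<n. y ^ i) \<le> 1"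
    by (rule vabs_sum_le) (use assms in \<open>auto simp: vabs_power vabs_ge_zero power_le_one\<close>)
  then have "vabs (y - 1) * vabs (\<Sum>i<n. y ^ i) \<le> vabs (y - 1)"
    by (simp add: vabs_ge_zero mult_left_le)
  then show ?thesis by (simp add: power_diff_1_eq vabs_mult)
qed

text \<open>This instance and the two after it make the general limit rules for sums, differences
  and products applicable to the class.\<close>

instance complete_nonarch_field \<subseteq> topological_group_add
proof
  fix a b :: 'a
  show "((\<lambda>x. fst x + snd x) \<longlongrightarrow> a + b) (nhds a \<times>\<^sub>F nhds b)"
    by (intro tendsto_add_nonarch filterlim_fst filterlim_snd)
  show "(uminus \<longlongrightarrow> - a) (nhds a)"
    using tendsto_mult_left_nonarch[of "\<lambda>x. x" a "nhds a" "- 1"] by (simp add: filterlim_ident)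
qed

instance complete_nonarch_field \<subseteq> topological_ab_group_add ..

instance complete_nonarch_field \<subseteq> topological_semigroup_mult
proof
  fix a b :: 'a
  let ?F = "nhds a \<times>\<^sub>F nhds b"
  have a: "(fst \<longlongrightarrow> a) ?F" and b: "(snd \<longlongrightarrow> b) ?F"
    by (intro filterlim_fst filterlim_snd)+
  \<comment> \<open>The product of the two errors vanishes in the limit; what remains of
    \<open>fst z * snd z\<close> is affine in both components.\<close>
  have "((\<lambda>z. (fst z - a) * (snd z - b)) \<longlongrightarrow> 0) ?F"
    using a b unfolding tendsto_nonarch_iff
    by (auto simp: vabs_mult intro: tendsto_mult_zero)
  moreover have "((\<lambda>z. a * snd z + b * fst z - a * b) \<longlongrightarrow> a * b + b * a - a * b) ?F"
    by (intro tendsto_diff tendsto_add tendsto_mult_left_nonarch a b tendsto_const)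
  ultimately have "((\<lambda>z. (fst z - a) * (snd z - b) + (a * snd z + b * fst z - a * b))
      \<longlongrightarrow> 0 + (a * b + b * a - a * b)) ?F"
    by (rule tendsto_add)
  then show "((\<lambda>z. fst z * snd z) \<longlongrightarrow> a * b) ?F"
    by (simp add: algebra_simps)
qed

section \<open>The p-adic absolute value on the integers\<close>

text \<open>In a Bezout relation \<open>u * p + v * k = 1\<close> the first summand is smaller than
  1, so the ultrametric inequality forces \<open>v * k\<close>, and with it \<open>k\<close>, to
  have size at least 1.\<close>

lemma vabs_of_int_eq_1:
  fixes k :: int
  assumes "prime p" "vabs (of_nat p :: 'a::complete_nonarch_field) = 1 / real p" "\<not> int p dvd k"
  shows "vabs (of_int k :: 'a) = 1"
proof -
  have "coprime (int p) k"
    using assms by (simp add: prime_imp_coprime)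
  then obtain u v where uv: "u * int p + v * k = 1"
    by (metis bezout_int coprime_iff_gcd_eq_1)
  have p: "vabs (of_int (u * int p) :: 'a) < 1"
  proof -
    have "vabs (of_int (u * int p) :: 'a) = vabs (of_int u :: 'a) * (1 / real p)"
      by (simp add: vabs_mult assms)
    also have "\<dots> \<le> 1 * (1 / real p)"
      by (intro mult_right_mono vabs_of_int_le) simp
    also have "\<dots> < 1" using prime_gt_1_nat[OF assms(1)] by simp
    finally show ?thesis .
  qed
  have "1 = vabs (of_int (u * int p) + of_int (v * k) :: 'a)"
    by (metis of_int_1 of_int_add uv vabs_one)
  also have "\<dots> \<le> max (vabs (of_int (u * int p) :: 'a)) (vabs (of_int (v * k) :: 'a))"
    by (rule vabs_add_le_max)
  finally have "1 \<le> vabs (of_int (v * k) :: 'a)" using p by simp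
  also have "\<dots> \<le> vabs (of_int k :: 'a)"
    by (simp add: vabs_mult vabs_of_int_le vabs_ge_zero mult_left_le_one_le)
  finally show ?thesis using vabs_of_int_le[of k, where 'a='a] by simp
qed

text \<open>Translates p-adic closeness of integers into congruence modulo \<open>p ^ N\<close>. The
  induction splits off one factor \<open>p\<close>; an integer without such a factor has absolute
  value 1.\<close>

lemma vabs_of_int_le_iff_dvd:
  fixes k :: int
  assumes "prime p" "vabs (of_nat p :: 'a::complete_nonarch_field) = 1 / real p"
  shows "vabs (of_int k :: 'a) \<le> (1 / real p) ^ N \<longleftrightarrow> int (p ^ N) dvd k"
proof (induction N arbitrary: k)
  case 0
  show ?case by (simp add: vabs_of_int_le)
next
  case (Suc N)
  have p: "real p > 1" using prime_gt_1_nat[OF assms(1)] by simp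
  show ?case
  proof (cases "int p dvd k")
    case True
    then obtain j where j: "k = int p * j" by blast
    have "vabs (of_int k :: 'a) = (1 / real p) * vabs (of_int j :: 'a)"
      by (simp add: j vabs_mult assms)
    then have "vabs (of_int k :: 'a) \<le> (1 / real p) ^ Suc N \<longleftrightarrow>
        vabs (of_int j :: 'a) \<le> (1 / real p) ^ N"
      using p by (simp add: divide_le_cancel)
    also have "\<dots> \<longleftrightarrow> int (p ^ Suc N) dvd k"
      using p by (simp add: Suc.IH j)
    finally show ?thesis .
  next
    case False
    have "(1 / real p) ^ Suc N < 1"
      using p by (intro power_Suc_less_one) auto
    moreover have "\<not> int (p ^ Suc N) dvd k"
      using False by (metis dvd_mult_left of_nat_mult power_Suc)
    ultimately show ?thesis
      using vabs_of_int_eq_1[OF assms False] by simp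
  qed
qed

lemma inverse_prime_power_less:
  assumes "prime p" "e > 0"
  obtains N where "(1 / real p) ^ N < e"
  using real_arch_pow_inv[of e "1 / real p"] assms prime_gt_1_nat[OF assms(1)] by auto

text \<open>A rational \<open>a / b\<close> close to \<open>x\<close> has denominator prime to
  \<open>p\<close>, so \<open>b\<close> is invertible modulo \<open>p ^ N\<close>, and a natural
  number congruent to \<open>a\<close> times that inverse approximates \<open>a / b\<close>.\<close>

lemma nat_dense_in_Zp:
  fixes x :: "'a::complete_nonarch_field"
  assumes p: "prime p" "vabs (of_nat p :: 'a) = 1 / real p" and x: "x \<in> Zp" and e: "e > 0"
  shows "\<exists>k. dist (of_nat k) x < e"
proof -
  \<comment> \<open>The bound 1 keeps \<open>y\<close> in the unit ball together with
    \<open>x\<close>.\<close>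
  obtain y where y: "y \<in> \<rat>" "dist y x < min e 1"
    using x e unfolding Zp_def Qp_def
    by (metis (no_types, lifting) closure_approachable mem_Collect_eq min_less_iff_conj zero_less_one)
  have "vabs y \<le> 1"
    using vabs_add_le_max[of "y - x" x] x y(2) by (auto simp: Zp_def dist_vabs max_def split: if_splits)
  obtain r where r: "y = of_rat r" using y(1) Rats_cases by metis
  obtain a b where ab: "quotient_of r = (a, b)" by fastforce
  have b0: "b > 0" and cop: "coprime a b"
    using ab quotient_of_denom_pos quotient_of_coprime by blast+
  have yab: "y * of_int b = of_int a"
    using quotient_of_div[OF ab] b0 by (simp add: r of_rat_divide)
  \<comment> \<open>In lowest terms, a denominator divisible by \<open>p\<close> would force
    \<open>vabs y > 1\<close>.\<close>
  have "\<not> int p dvd b"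
  proof
    assume d: "int p dvd b"
    have "\<not> int p dvd a"
      using cop d p(1) by (metis coprime_common_divisor not_prime_unit prime_int_nat_transfer nat_int
          prime_nat_int_transfer)
    then have "vabs (of_int a :: 'a) = 1" by (rule vabs_of_int_eq_1[OF p])
    moreover have "vabs (of_int b :: 'a) < 1"
    proof -
      have "vabs (of_int b :: 'a) \<le> (1 / real p) ^ 1"
        using d by (subst vabs_of_int_le_iff_dvd[OF p]) simp
      also have "\<dots> < 1" using prime_gt_1_nat[OF p(1)] by simp
      finally show ?thesis .
    qed
    ultimately show False
      using \<open>vabs y \<le> 1\<close> yab vabs_mult[of y "of_int b"] vabs_ge_zero[of "of_int b :: 'a"]
      by (metis mult_left_le_one_le not_le vabs_ge_zero)
  qed
  then have b1: "vabs (of_int b :: 'a) = 1" by (rule vabs_of_int_eq_1[OF p])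
  obtain N where N: "(1 / real p) ^ N < e" using inverse_prime_power_less[OF p(1) e] .
  have "coprime b (int (p ^ N))"
    using \<open>\<not> int p dvd b\<close> p(1)
    by (metis coprime_commute coprime_power_right_iff of_nat_power prime_imp_coprime
        prime_nat_int_transfer)
  then obtain c where c: "[b * c = 1] (mod int (p ^ N))"
    using cong_solve_coprime_int by blast
  define k where "k = nat (a * c mod int (p ^ N))"
  have pN: "int (p ^ N) > 0" using prime_gt_0_nat[OF p(1)] by simp
  have "[int k = a * c] (mod int (p ^ N))"
    using pN by (simp add: k_def cong_def del: of_nat_power)
  then have "[b * int k = b * (a * c)] (mod int (p ^ N))"
    by (rule cong_scalar_left)
  also have "b * (a * c) = a * (b * c)" by simp
  also have "[a * (b * c) = a * 1] (mod int (p ^ N))"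
    using c by (rule cong_scalar_left)
  finally have "int (p ^ N) dvd b * int k - a"
    by (simp add: cong_iff_dvd_diff)
  then have "vabs (of_int (b * int k - a) :: 'a) \<le> (1 / real p) ^ N"
    by (simp only: vabs_of_int_le_iff_dvd[OF p])
  \<comment> \<open>As \<open>b\<close> has absolute value 1, the congruence for
    \<open>b * k - a\<close> is the same estimate for \<open>k - y\<close>.\<close>
  moreover have "of_int (b * int k - a) = of_int b * (of_nat k - y)"
    by (simp add: yab[symmetric] algebra_simps)
  ultimately have "vabs (of_nat k - y) < e"
    using N b1 by (simp add: vabs_mult)
  then have "vabs ((of_nat k - y) + (y - x)) < e"
    using y(2) vabs_add_le_max[of "of_nat k - y" "y - x"]
    by (auto simp: dist_vabs max_def split: if_splits)
  then show ?thesis by (auto simp: dist_vabs)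
qed

lemma nat_seq_tendsto_Zp:
  fixes x :: "'a::complete_nonarch_field"
  assumes "prime p" "vabs (of_nat p :: 'a) = 1 / real p" "x \<in> Zp"
  obtains s where "(\<lambda>k. of_nat (s k)) \<longlonglongrightarrow> x"
proof -
  have "\<exists>m. dist (of_nat m) x < 1 / real (Suc k)" for k
    using nat_dense_in_Zp[OF assms] by simp
  then obtain s where s: "dist (of_nat (s k)) x < 1 / real (Suc k)" for k
    by metis
  have "(\<lambda>k. dist (of_nat (s k)) x) \<longlonglongrightarrow> 0"
    by (rule tendsto_sandwich[OF _ _ tendsto_const LIMSEQ_inverse_real_of_nat])
       (use s in \<open>auto simp: less_imp_le inverse_eq_divide\<close>)
  then have "(\<lambda>k. of_nat (s k)) \<longlonglongrightarrow> x"
    by (subst tendsto_dist_iff)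
  then show ?thesis by (rule that)
qed

section \<open>Powers with p-adic exponents\<close>

text \<open>Each p-th power shrinks the distance to 1 by the factor \<open>c\<close>: with
  \<open>y = q ^ p ^ N\<close>, the cofactor of \<open>y - 1\<close> in \<open>y ^ p - 1\<close> is
  \<open>p\<close> plus terms \<open>y ^ i - 1\<close>, all of size at most
  \<open>c\<close>.\<close>

lemma power_prime_power_tendsto_1:
  fixes q :: "'a::complete_nonarch_field"
  assumes p: "prime p" "vabs (of_nat p :: 'a) = 1 / real p" and q: "vabs (1 - q) < 1"
  shows "(\<lambda>N. q ^ p ^ N) \<longlonglongrightarrow> 1"
proof -
  define c where "c = max (vabs (1 - q)) (1 / real p)"
  have c: "0 \<le> c" "c < 1"
    using q prime_gt_1_nat[OF p(1)] by (auto simp: c_def le_max_iff_disj)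
  have q1: "vabs q = 1" using vabs_eq_1[OF q] .
  have "vabs (q ^ p ^ N - 1) \<le> c ^ N" for N
  proof (induction N)
    case 0
    show ?case using q by (simp add: vabs_minus_commute[of q])
  next
    case (Suc N)
    define y where "y = q ^ p ^ N"
    have y: "vabs y = 1" by (simp add: y_def vabs_power q1)
    have "vabs (y - 1) \<le> c"
      using vabs_power_minus_1_le[of q "p ^ N"] q1
      by (simp add: y_def c_def vabs_minus_commute[of q])
    have "vabs (\<Sum>i<p. y ^ i - 1) \<le> c"
    proof (rule vabs_sum_le)
      show "vabs (y ^ i - 1) \<le> c" for i
        using vabs_power_minus_1_le[of y i] y \<open>vabs (y - 1) \<le> c\<close> by simp
    qed (use c in simp)
    moreover have "(\<Sum>i<p. y ^ i) = (\<Sum>i<p. y ^ i - 1) + of_nat p"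
      by (simp add: sum_subtractf)
    ultimately have S: "vabs (\<Sum>i<p. y ^ i) \<le> c"
      using vabs_add_le_max[of "\<Sum>i<p. y ^ i - 1" "of_nat p"] p(2) c_def by simp
    have "q ^ p ^ Suc N - 1 = y ^ p - 1"
      by (simp add: y_def flip: power_mult) (simp add: mult.commute)
    also have "\<dots> = (y - 1) * (\<Sum>i<p. y ^ i)" by (rule power_diff_1_eq)
    finally have "vabs (q ^ p ^ Suc N - 1) = vabs (y - 1) * vabs (\<Sum>i<p. y ^ i)"
      by (simp add: vabs_mult)
    also have "\<dots> \<le> c ^ N * c"
      using Suc.IH S c by (intro mult_mono) (auto simp: y_def vabs_ge_zero)
    finally show ?case by (simp add: mult.commute)
  qed
  moreover have "(\<lambda>N. c ^ N) \<longlonglongrightarrow> 0"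
    using c by (intro LIMSEQ_realpow_zero)
  ultimately show ?thesis unfolding tendsto_nonarch_iff
    by (intro tendsto_sandwich[OF _ _ tendsto_const \<open>(\<lambda>N. c ^ N) \<longlonglongrightarrow> 0\<close>])
       (auto simp: vabs_ge_zero)
qed

text \<open>Exponents that are p-adically close differ by a multiple of \<open>p ^ N\<close>, so the
  powers differ by at most \<open>vabs (q ^ p ^ N - 1)\<close>, which is small for large
  \<open>N\<close>.\<close>

lemma power_uniformly_continuous:
  fixes q :: "'a::complete_nonarch_field"
  assumes p: "prime p" "vabs (of_nat p :: 'a) = 1 / real p" and q: "vabs (1 - q) < 1"
    and e: "e > 0"
  obtains d where "d > 0"
    "\<And>m n. dist (of_nat m :: 'a) (of_nat n) < d \<Longrightarrow> dist (q ^ m) (q ^ n) < e"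
proof -
  have q1: "vabs q = 1" using vabs_eq_1[OF q] .
  have "\<forall>\<^sub>F N in sequentially. dist (q ^ p ^ N) 1 < e"
    using power_prime_power_tendsto_1[OF p q] e by (rule tendstoD)
  then obtain N where N: "vabs (q ^ p ^ N - 1) < e"
    unfolding eventually_sequentially dist_vabs by blast
  have le: "dist (q ^ m) (q ^ n) < e"
    if "n \<le> m" "dist (of_nat m :: 'a) (of_nat n) < (1 / real p) ^ N" for m n
  proof -
    have "vabs (of_int (int (m - n)) :: 'a) \<le> (1 / real p) ^ N"
      using that by (simp add: dist_vabs of_nat_diff)
    then have "int (p ^ N) dvd int (m - n)"
      by (simp only: vabs_of_int_le_iff_dvd[OF p])
    then obtain k where k: "m - n = p ^ N * k"
      by (metis dvdE int_dvd_int_iff)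
    have "q ^ m - q ^ n = q ^ n * (q ^ (m - n) - 1)"
      using that(1) by (simp add: right_diff_distrib flip: power_add)
    then have "dist (q ^ m) (q ^ n) = vabs ((q ^ p ^ N) ^ k - 1)"
      by (simp add: dist_vabs vabs_mult vabs_power q1 k power_mult)
    also have "\<dots> \<le> vabs (q ^ p ^ N - 1)"
      by (rule vabs_power_minus_1_le) (simp add: vabs_power q1)
    finally show ?thesis using N by simp
  qed
  show thesis
  proof (rule that)
    show "(1 / real p) ^ N > 0" using prime_gt_0_nat[OF p(1)] by simp
    show "dist (q ^ m) (q ^ n) < e"
      if "dist (of_nat m :: 'a) (of_nat n) < (1 / real p) ^ N" for m n
      using le[of m n] le[of n m] that by (metis dist_commute nat_le_linear)
  qed
qed

text \<open>Completeness gives a limit along the one sequence \<open>s\<close>; uniform continuity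
  carries it over to the whole filter that defines \<open>padic_pow\<close>. Identities for
  \<open>padic_pow\<close> then follow from those for natural exponents.\<close>

lemma padic_pow_tendsto:
  fixes q x :: "'a::complete_nonarch_field"
  assumes p: "prime p" "vabs (of_nat p :: 'a) = 1 / real p" and q: "vabs (1 - q) < 1"
    and s: "(\<lambda>k. of_nat (s k)) \<longlonglongrightarrow> x"
  shows "(\<lambda>k. q ^ s k) \<longlonglongrightarrow> padic_pow q x"
proof -
  let ?F = "filtercomap (of_nat :: nat \<Rightarrow> 'a) (nhds x)"
  have sF: "filterlim s ?F sequentially"
    unfolding filterlim_filtercomap_iff using s by (simp add: o_def)
  \<comment> \<open>\<open>Lim\<close> picks a definite value only on a nontrivial filter; the
    sequence \<open>s\<close> shows that this one is nontrivial.\<close>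
  have nb: "?F \<noteq> bot"
    using sF by (metis filterlim_def filtermap_bot_iff le_bot sequentially_bot)
  have "Cauchy (\<lambda>k. q ^ s k)"
  proof (rule metric_CauchyI)
    fix e :: real assume "e > 0"
    then obtain d where d: "d > 0"
      "\<And>m n. dist (of_nat m :: 'a) (of_nat n) < d \<Longrightarrow> dist (q ^ m) (q ^ n) < e"
      using power_uniformly_continuous[OF p q] by blast
    have "Cauchy (\<lambda>k. of_nat (s k) :: 'a)" using s by (rule LIMSEQ_imp_Cauchy)
    then show "\<exists>M. \<forall>m\<ge>M. \<forall>n\<ge>M. dist (q ^ s m) (q ^ s n) < e"
      using d metric_CauchyD by metis
  qed
  then obtain L where L: "(\<lambda>k. q ^ s k) \<longlonglongrightarrow> L"
    using Cauchy_convergent convergent_def by blast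
  have "((\<lambda>n. q ^ n) \<longlongrightarrow> L) ?F"
  proof (rule tendstoI)
    fix e :: real assume e: "e > 0"
    then obtain d where d: "d > 0"
      "\<And>m n. dist (of_nat m :: 'a) (of_nat n) < d \<Longrightarrow> dist (q ^ m) (q ^ n) < e / 2"
      using power_uniformly_continuous[OF p q, of "e / 2"] by auto
    have "\<forall>\<^sub>F k in sequentially. dist (of_nat (s k)) x < d / 2 \<and> dist (q ^ s k) L < e / 2"
      using tendstoD[OF s, of "d / 2"] tendstoD[OF L, of "e / 2"] d(1) e
      by (auto intro: eventually_conj)
    then obtain k where k: "dist (of_nat (s k)) x < d / 2" "dist (q ^ s k) L < e / 2"
      unfolding eventually_sequentially by blast
    have "\<forall>\<^sub>F y in nhds x. dist y x < d / 2"
      using d(1) by (auto simp: eventually_nhds_metric intro!: exI[of _ "d / 2"])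
    then have "\<forall>\<^sub>F n in ?F. dist (of_nat n) x < d / 2"
      by (rule eventually_filtercomapI)
    then show "\<forall>\<^sub>F n in ?F. dist (q ^ n) L < e"
    proof eventually_elim
      case (elim n)
      have "dist (of_nat n :: 'a) (of_nat (s k)) < d"
        using elim k(1) by (rule dist_triangle_half_l)
      then have "dist (q ^ n) (q ^ s k) < e / 2" by (rule d(2))
      then show ?case using k(2) dist_triangle[of "q ^ n" L "q ^ s k"] by simp
    qed
  qed
  then have "padic_pow q x = L"
    unfolding padic_pow_def using nb by (intro tendsto_Lim)
  then show ?thesis using L by simp
qed

lemma padic_pow_of_nat:
  fixes q :: "'a::complete_nonarch_field"
  assumes "prime p" "vabs (of_nat p :: 'a) = 1 / real p" "vabs (1 - q) < 1"
  shows "padic_pow q (of_nat n) = q ^ n"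
  using padic_pow_tendsto[OF assms, of "\<lambda>_. n" "of_nat n"]
  by (simp add: LIMSEQ_const_iff)

lemma padic_pow_add_of_nat:
  fixes q x :: "'a::complete_nonarch_field"
  assumes "prime p" "vabs (of_nat p :: 'a) = 1 / real p" "vabs (1 - q) < 1" "x \<in> Zp"
  shows "padic_pow q (x + of_nat n) = padic_pow q x * q ^ n"
proof -
  obtain s where s: "(\<lambda>k. of_nat (s k)) \<longlonglongrightarrow> x"
    using nat_seq_tendsto_Zp[OF assms(1,2,4)] .
  have "(\<lambda>k. of_nat (s k + n)) \<longlonglongrightarrow> x + of_nat n"
    unfolding of_nat_add by (intro tendsto_add s tendsto_const)
  then have "(\<lambda>k. q ^ (s k + n)) \<longlonglongrightarrow> padic_pow q (x + of_nat n)"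
    by (rule padic_pow_tendsto[OF assms(1-3)])
  moreover have "(\<lambda>k. q ^ (s k + n)) \<longlonglongrightarrow> padic_pow q x * q ^ n"
    unfolding power_add by (intro tendsto_mult tendsto_const padic_pow_tendsto[OF assms(1-3) s])
  ultimately show ?thesis by (rule LIMSEQ_unique)
qed

lemma padic_pow_of_nat_mult:
  fixes q x :: "'a::complete_nonarch_field"
  assumes "prime p" "vabs (of_nat p :: 'a) = 1 / real p" "vabs (1 - q) < 1" "x \<in> Zp"
  shows "padic_pow q (of_nat l * x) = padic_pow q x ^ l"
proof -
  obtain s where s: "(\<lambda>k. of_nat (s k)) \<longlonglongrightarrow> x"
    using nat_seq_tendsto_Zp[OF assms(1,2,4)] .
  have "(\<lambda>k. of_nat (l * s k)) \<longlonglongrightarrow> of_nat l * x"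
    unfolding of_nat_mult by (intro tendsto_mult s tendsto_const)
  then have "(\<lambda>k. q ^ (l * s k)) \<longlonglongrightarrow> padic_pow q (of_nat l * x)"
    by (rule padic_pow_tendsto[OF assms(1-3)])
  moreover have "(\<lambda>k. q ^ (l * s k)) \<longlonglongrightarrow> padic_pow q x ^ l"
  proof (induction l)
    case (Suc l)
    then show ?case
      unfolding power_Suc mult_Suc power_add
      by (intro tendsto_mult padic_pow_tendsto[OF assms(1-3) s])
  qed simp
  ultimately show ?thesis by (rule LIMSEQ_unique)
qed

section \<open>Fermionic integrals of exponentials\<close>

text \<open>If \<open>a = - 1\<close> then \<open>1 - a = 2\<close>, which has absolute value 1
  because \<open>p\<close> is odd.\<close>

lemma one_plus_nonzero:
  fixes a :: "'a::complete_nonarch_field"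
  assumes "prime p" "odd p" "vabs (of_nat p :: 'a) = 1 / real p" "vabs (1 - a) < 1"
  shows "1 + a \<noteq> 0"
proof
  assume "1 + a = 0"
  then have "a = - 1" by (simp add: add_eq_0_iff)
  then have "1 - a = of_int 2" by simp
  moreover have "\<not> int p dvd 2"
    using assms(1,2) by (metis dvd_refl int_dvd_int_iff of_nat_numeral primes_dvd_imp_eq two_is_prime_nat)
  then have "vabs (of_int 2 :: 'a) = 1" by (rule vabs_of_int_eq_1[OF assms(1,3)])
  ultimately show False using assms(4) by (metis less_irrefl)
qed

text \<open>The elements at distance less than 1 from 1 are closed under products, so every base
  \<open>w * q ^ j\<close> met below qualifies for the integral formula.\<close>

lemma vabs_one_minus_mult_less:
  fixes a b :: "'a::complete_nonarch_field"
  assumes "vabs (1 - a) < 1" "vabs (1 - b) < 1"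
  shows "vabs (1 - a * b) < 1"
proof -
  have "vabs ((1 - a) + a * (1 - b)) < 1"
    using vabs_add_le_max[of "1 - a" "a * (1 - b)"] assms by (simp add: vabs_mult vabs_eq_1)
  then show ?thesis by (simp add: algebra_simps)
qed

lemma vabs_one_minus_power_less:
  fixes a :: "'a::complete_nonarch_field"
  assumes "vabs (1 - a) < 1"
  shows "vabs (1 - a ^ n) < 1"
  by (induction n) (simp_all add: assms vabs_one_minus_mult_less)

lemma alternating_power_sum_tendsto:
  fixes a :: "'a::complete_nonarch_field"
  assumes "prime p" "odd p" "vabs (of_nat p :: 'a) = 1 / real p" "vabs (1 - a) < 1"
  shows "(\<lambda>N. \<Sum>t<p ^ N. a ^ t * (-1) ^ t) \<longlonglongrightarrow> 2 / (1 + a)"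
proof -
  have nz: "1 + a \<noteq> 0" using one_plus_nonzero[OF assms] .
  have "(\<Sum>t<p ^ N. a ^ t * (-1) ^ t) = inverse (1 + a) * (1 + a ^ p ^ N)" for N
  proof -
    have "(\<Sum>t<p ^ N. a ^ t * (-1) ^ t) = (\<Sum>t<p ^ N. (- a) ^ t)"
      by (simp flip: power_mult_distrib)
    moreover have "1 - (- a) ^ p ^ N = (1 + a) * (\<Sum>t<p ^ N. (- a) ^ t)"
      using one_diff_power_eq[of "- a" "p ^ N"] by simp
    moreover have "(- a) ^ p ^ N = - (a ^ p ^ N)"
      using assms(2) by (simp add: power_minus_odd)
    ultimately show ?thesis using nz by (simp add: field_simps)
  qed
  moreover have "(\<lambda>N. inverse (1 + a) * (1 + a ^ p ^ N)) \<longlonglongrightarrow> inverse (1 + a) * (1 + 1)"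
    by (intro tendsto_mult tendsto_add tendsto_const
        power_prime_power_tendsto_1[OF assms(1,3,4)])
  ultimately show ?thesis by (simp add: field_simps)
qed

lemma fermionic_integral_exponential_sum:
  fixes a c :: "'b \<Rightarrow> 'a::complete_nonarch_field"
  assumes "prime p" "odd p" "vabs (of_nat p :: 'a) = 1 / real p"
    and "\<And>l. l \<in> A \<Longrightarrow> vabs (1 - a l) < 1"
    and f: "\<And>t. f (of_nat t) = (\<Sum>l\<in>A. c l * a l ^ t)"
  shows "fermionic_integral p f = (\<Sum>l\<in>A. c l * (2 / (1 + a l)))"
proof -
  have "(\<Sum>t<p ^ N. f (of_nat t) * (-1) ^ t) =
      (\<Sum>l\<in>A. c l * (\<Sum>t<p ^ N. a l ^ t * (-1) ^ t))" for N
    unfolding f sum_distrib_left sum_distrib_right by (subst sum.swap) (simp add: mult.assoc)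
  moreover have "(\<lambda>N. \<Sum>l\<in>A. c l * (\<Sum>t<p ^ N. a l ^ t * (-1) ^ t))
      \<longlonglongrightarrow> (\<Sum>l\<in>A. c l * (2 / (1 + a l)))"
    by (intro tendsto_sum tendsto_mult tendsto_const alternating_power_sum_tendsto assms)
  ultimately show ?thesis
    unfolding fermionic_integral_def by (simp add: limI)
qed

text \<open>Freezing the outermost variable at \<open>t\<close> moves its factor
  \<open>a l (Suc r) ^ t\<close> into the coefficient; hence the induction leaves both
  \<open>f\<close> and \<open>c\<close> arbitrary.\<close>

lemma fermionic_integral_iter_exponential_sum:
  fixes a :: "'b \<Rightarrow> nat \<Rightarrow> 'a::complete_nonarch_field"
  assumes "prime p" "odd p" "vabs (of_nat p :: 'a) = 1 / real p"
    and "\<And>l i. l \<in> A \<Longrightarrow> vabs (1 - a l i) < 1"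
    and "\<And>k. f (\<lambda>i. of_nat (k i)) = (\<Sum>l\<in>A. c l * (\<Prod>i=1..r. a l i ^ k i))"
  shows "fermionic_integral_iter p r f = (\<Sum>l\<in>A. c l * (\<Prod>i=1..r. 2 / (1 + a l i)))"
  using assms(5)
proof (induction r arbitrary: f c)
  case 0
  then show ?case using "0"[of "\<lambda>_. 0"] by simp
next
  case (Suc r)
  have "fermionic_integral_iter p r (\<lambda>y. f (y(Suc r := of_nat t))) =
      (\<Sum>l\<in>A. (c l * a l (Suc r) ^ t) * (\<Prod>i=1..r. 2 / (1 + a l i)))" for t
  proof (rule Suc.IH)
    fix k :: "nat \<Rightarrow> nat"
    have "(\<lambda>i. of_nat (k i) :: 'a)(Suc r := of_nat t) = (\<lambda>i. of_nat ((k(Suc r := t)) i))"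
      by auto
    then have "f ((\<lambda>i. of_nat (k i))(Suc r := of_nat t)) =
        (\<Sum>l\<in>A. c l * (\<Prod>i=1..Suc r. a l i ^ (k(Suc r := t)) i))"
      by (simp only: Suc.prems)
    also have "\<dots> = (\<Sum>l\<in>A. (c l * a l (Suc r) ^ t) * (\<Prod>i=1..r. a l i ^ k i))"
    proof (rule sum.cong)
      fix l
      have "(\<Prod>i=1..r. a l i ^ (k(Suc r := t)) i) = (\<Prod>i=1..r. a l i ^ k i)"
        by (rule prod.cong) auto
      then show "c l * (\<Prod>i=1..Suc r. a l i ^ (k(Suc r := t)) i) =
          c l * a l (Suc r) ^ t * (\<Prod>i=1..r. a l i ^ k i)"
        by (simp add: mult_ac)
    qed simp
    finally show "f ((\<lambda>i. of_nat (k i))(Suc r := of_nat t)) =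
        (\<Sum>l\<in>A. (c l * a l (Suc r) ^ t) * (\<Prod>i=1..r. a l i ^ k i))" .
  qed
  \<comment> \<open>The inner integrals are constants, so as a function of \<open>t\<close> this is
    again a sum of exponentials, ready for the outermost integration.\<close>
  then have "fermionic_integral_iter p r (\<lambda>y. f (y(Suc r := of_nat t))) =
      (\<Sum>l\<in>A. (c l * (\<Prod>i=1..r. 2 / (1 + a l i))) * a l (Suc r) ^ t)" for t
    by (simp add: mult_ac)
  then have "fermionic_integral_iter p (Suc r) f =
      (\<Sum>l\<in>A. (c l * (\<Prod>i=1..r. 2 / (1 + a l i))) * (2 / (1 + a l (Suc r))))"
    unfolding fermionic_integral_iter.simps
    by (intro fermionic_integral_exponential_sum assms)
  then show ?case by (simp add: mult_ac)
qed

section \<open>The q-binomial series\<close>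

text \<open>The q-binomial theorem with its denominator cleared. By a q-Pascal rule, multiplying by
  \<open>1 - a * q ^ r * X\<close> lowers the parameter of the series from \<open>Suc r\<close> to
  \<open>r\<close>.\<close>

lemma q_binomial_series:
  fixes q a :: "'a::field"
  assumes q: "\<And>k. k \<ge> 1 \<Longrightarrow> q ^ k \<noteq> 1"
  shows "fps_of_poly (\<Prod>j<r. [:1, - (a * q ^ j):]) *
      Abs_fps (\<lambda>m. (\<Prod>i<m. (1 - q ^ (r + i)) / (1 - q ^ Suc i)) * a ^ m) = 1"
proof (induction r)
  case 0
  \<comment> \<open>For \<open>r = 0\<close> the factor at \<open>i = 0\<close> vanishes, so only
    the constant term 1 survives.\<close>
  have "(\<Prod>i<m. (1 - q ^ i) / (1 - q ^ Suc i)) = 0" if "m \<noteq> 0" for m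
    using that by (intro prod_zero) (auto intro!: bexI[of _ 0])
  then show ?case by (auto simp: fps_eq_iff)
next
  case (Suc r)
  let ?b = "\<lambda>r m. \<Prod>i<m. (1 - q ^ (r + i)) / (1 - q ^ Suc i)"
  let ?B = "\<lambda>r. Abs_fps (\<lambda>m. ?b r m * a ^ m)"
  have step: "?b (Suc r) (Suc m) - q ^ r * ?b (Suc r) m = ?b r (Suc m)" for m
  proof -
    \<comment> \<open>The common factor of the three coefficients; the rule reduces to
      \<open>(1 - q ^ (Suc r + m)) - q ^ r * (1 - q ^ Suc m) = 1 - q ^ r\<close>.\<close>
    define T where "T = (\<Prod>i<m. 1 - q ^ (Suc r + i)) / (\<Prod>i<Suc m. 1 - q ^ Suc i)"
    have nz: "1 - q ^ Suc i \<noteq> 0" for i using q[of "Suc i"] by (simp del: power_Suc)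
    have "?b (Suc r) (Suc m) = T * (1 - q ^ (Suc r + m))"
      unfolding T_def prod_dividef by (simp del: power_Suc)
    moreover have "?b (Suc r) m = T * (1 - q ^ Suc m)"
      unfolding T_def prod_dividef using nz[of m] by (simp del: power_Suc)
    moreover have "?b r (Suc m) = T * (1 - q ^ r)"
      unfolding T_def prod_dividef prod.lessThan_Suc_shift[of "\<lambda>i. 1 - q ^ (r + i)"]
      by (simp del: power_Suc)
    ultimately show ?thesis
      by (simp only:) (simp add: algebra_simps power_add)
  qed
  have "fps_of_poly [:1, - (a * q ^ r):] * ?B (Suc r) = ?B r"
  proof (rule fps_ext)
    fix m
    have eq: "fps_of_poly [:1, - (a * q ^ r):] * ?B (Suc r) =
        ?B (Suc r) - fps_const (a * q ^ r) * (fps_X * ?B (Suc r))"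
      by (simp add: fps_of_poly_pCons algebra_simps flip: fps_const_neg)
    show "fps_nth (fps_of_poly [:1, - (a * q ^ r):] * ?B (Suc r)) m = fps_nth (?B r) m"
    proof (cases m)
      case (Suc k)
      have "?b (Suc r) (Suc k) * a ^ Suc k - a * q ^ r * (?b (Suc r) k * a ^ k) =
          (?b (Suc r) (Suc k) - q ^ r * ?b (Suc r) k) * a ^ Suc k"
        by (simp add: algebra_simps)
      then show ?thesis
        unfolding eq step Suc
        by (simp only: fps_sub_nth fps_mult_left_const_nth fps_X_mult_nth fps_nth_Abs_fps) simp
    qed simp
  qed
  then show ?case
    using Suc.IH by (simp only: prod.lessThan_Suc fps_of_poly_mult mult.assoc)
qed

section \<open>Linearity of the rational summation\<close>

text \<open>This rule and the elimination rule below replace the quotient of power series by a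
  product identity, which is easier to combine algebraically.\<close>

lemma power_series_sumsI:
  assumes "poly Q 0 \<noteq> 0" "poly Q w \<noteq> 0"
    and "fps_of_poly Q * Abs_fps c = fps_of_poly P"
  shows "power_series_sums c w (poly P w / poly Q w)"
proof -
  have "fps_of_poly Q \<noteq> 0" using assms(1) by auto
  then have "Abs_fps c = fps_of_poly P / fps_of_poly Q"
    unfolding assms(3)[symmetric] by simp
  then show ?thesis unfolding power_series_sums_def using assms by blast
qed

lemma power_series_sumsE:
  assumes "power_series_sums c w S"
  obtains P Q where "poly Q 0 \<noteq> 0" "poly Q w \<noteq> 0" "S = poly P w / poly Q w"
    "fps_of_poly Q * Abs_fps c = fps_of_poly P"
  using assms fps_of_poly_eq_divide unfolding power_series_sums_def by blast

lemma power_series_sums_0: "power_series_sums (\<lambda>_. 0) w 0"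
  using power_series_sumsI[of 1 w "\<lambda>_. 0" 0] by (simp add: fps_eq_iff)

lemma power_series_sums_add:
  assumes "power_series_sums c w S" "power_series_sums d w T"
  shows "power_series_sums (\<lambda>m. c m + d m) w (S + T)"
proof -
  obtain P Q where 1: "poly Q 0 \<noteq> 0" "poly Q w \<noteq> 0" "S = poly P w / poly Q w"
    "fps_of_poly Q * Abs_fps c = fps_of_poly P"
    using assms(1) by (rule power_series_sumsE)
  obtain P' Q' where 2: "poly Q' 0 \<noteq> 0" "poly Q' w \<noteq> 0" "T = poly P' w / poly Q' w"
    "fps_of_poly Q' * Abs_fps d = fps_of_poly P'"
    using assms(2) by (rule power_series_sumsE)
  have "Abs_fps (\<lambda>m. c m + d m) = Abs_fps c + Abs_fps d" by (simp add: fps_eq_iff)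
  then have "fps_of_poly (Q * Q') * Abs_fps (\<lambda>m. c m + d m) =
      fps_of_poly Q' * (fps_of_poly Q * Abs_fps c) + fps_of_poly Q * (fps_of_poly Q' * Abs_fps d)"
    by (simp add: fps_of_poly_mult algebra_simps)
  also have "\<dots> = fps_of_poly (Q' * P + Q * P')"
    by (simp add: 1 2 fps_of_poly_mult fps_of_poly_add)
  finally have "power_series_sums (\<lambda>m. c m + d m) w (poly (Q' * P + Q * P') w / poly (Q * Q') w)"
    using 1 2 by (intro power_series_sumsI) auto
  then show ?thesis using 1 2 by (simp add: add_frac_eq mult.commute)
qed

lemma power_series_sums_cmult:
  assumes "power_series_sums c w S"
  shows "power_series_sums (\<lambda>m. k * c m) w (k * S)"
proof -
  obtain P Q where 1: "poly Q 0 \<noteq> 0" "poly Q w \<noteq> 0" "S = poly P w / poly Q w"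
    "fps_of_poly Q * Abs_fps c = fps_of_poly P"
    using assms by (rule power_series_sumsE)
  have "Abs_fps (\<lambda>m. k * c m) = fps_const k * Abs_fps c" by (simp add: fps_eq_iff)
  then have "fps_of_poly Q * Abs_fps (\<lambda>m. k * c m) = fps_const k * (fps_of_poly Q * Abs_fps c)"
    by (simp add: mult_ac)
  also have "\<dots> = fps_of_poly (smult k P)" by (simp add: 1 fps_of_poly_smult)
  finally have "power_series_sums (\<lambda>m. k * c m) w (poly (smult k P) w / poly Q w)"
    using 1 by (intro power_series_sumsI)
  then show ?thesis using 1 by simp
qed

lemma power_series_sums_sum:
  assumes "\<And>l. l \<in> A \<Longrightarrow> power_series_sums (c l) w (S l)"
  shows "power_series_sums (\<lambda>m. \<Sum>l\<in>A. c l m) w (\<Sum>l\<in>A. S l)"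
  using assms
  by (induction A rule: infinite_finite_induct)
     (auto intro: power_series_sums_0 power_series_sums_add)

text \<open>The denominator of the q-binomial series is a polynomial with constant term 1 whose
  value at \<open>w\<close> is exactly \<open>qpoch (a * w) q r\<close>; the numerator is 1.\<close>

lemma power_series_sums_q_binomial:
  fixes q a w :: "'a::complete_nonarch_field"
  assumes "\<And>k. k \<ge> 1 \<Longrightarrow> q ^ k \<noteq> 1" "qpoch (a * w) q r \<noteq> 0"
  shows "power_series_sums (\<lambda>m. (\<Prod>i<m. (1 - q ^ (r + i)) / (1 - q ^ Suc i)) * a ^ m) w
      (1 / qpoch (a * w) q r)"
proof -
  let ?Q = "\<Prod>j<r. [:1, - (a * q ^ j):]"
  have "poly ?Q w = qpoch (a * w) q r"
    by (simp add: poly_prod qpoch_def mult_ac)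
  moreover have "poly ?Q 0 \<noteq> 0" by (simp add: poly_prod)
  ultimately show ?thesis
    using power_series_sumsI[of ?Q w _ 1] q_binomial_series[OF assms(1), where r = r and a = a] assms(2)
    by simp
qed

section \<open>The twisted q-Euler polynomials\<close>

lemma qnum_of_nat:
  fixes q :: "'a::complete_nonarch_field"
  assumes "prime p" "vabs (of_nat p :: 'a) = 1 / real p" "vabs (1 - q) < 1"
  shows "qnum q (of_nat k) = (1 - q ^ k) / (1 - q)"
  by (simp add: qnum_def padic_pow_of_nat[OF assms])

lemma qbinom_eq_prod:
  fixes q :: "'a::complete_nonarch_field"
  assumes p: "prime p" "vabs (of_nat p :: 'a) = 1 / real p" and q: "vabs (1 - q) < 1" "q \<noteq> 1"
    and "r \<ge> 1"
  shows "qbinom q (m + r - 1) m = (\<Prod>i<m. (1 - q ^ (r + i)) / (1 - q ^ Suc i))"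
proof -
  have "(\<Prod>j<m. qnum q (of_nat (m + r - 1) - of_nat j)) = (\<Prod>j<m. (1 - q ^ (r + (m - Suc j))) / (1 - q))"
  proof (rule prod.cong)
    fix j assume "j \<in> {..<m}"
    \<comment> \<open>For \<open>j < m\<close> no subtraction is truncated, so the argument of
      \<open>qnum\<close> is a natural number and its power of \<open>q\<close> an ordinary
      one.\<close>
    then have "of_nat (m + r - 1) - of_nat j = (of_nat (r + (m - Suc j)) :: 'a)"
      using assms(5) by (subst of_nat_diff[symmetric]) (auto intro!: arg_cong[of _ _ of_nat])
    then show "qnum q (of_nat (m + r - 1) - of_nat j) = (1 - q ^ (r + (m - Suc j))) / (1 - q)"
      by (simp only: qnum_of_nat[OF p q(1)])
  qed simp
  \<comment> \<open>The definition runs downwards from the top factor; reversing the order aligns it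
    with the factors of \<open>qfact\<close>.\<close>
  also have "\<dots> = (\<Prod>i<m. (1 - q ^ (r + i)) / (1 - q))"
    by (rule prod.nat_diff_reindex)
  finally have num: "(\<Prod>j<m. qnum q (of_nat (m + r - 1) - of_nat j)) =
      (\<Prod>i<m. (1 - q ^ (r + i)) / (1 - q))" .
  have den: "qfact q m = (\<Prod>i<m. (1 - q ^ Suc i) / (1 - q))"
    unfolding qfact_def qnum_of_nat[OF p q(1)]
    by (simp add: prod.atLeast1_atMost_eq)
  show ?thesis
    unfolding qbinom_def num den prod_dividef[symmetric] using q(2) by (intro prod.cong) auto
qed

text \<open>The form isolates the dependence on \<open>m\<close> in the exponentials
  \<open>(q ^ l) ^ m\<close>; it serves both the integrand and the coefficients of the
  series.\<close>

lemma qnum_power_expand: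
  fixes q x :: "'a::complete_nonarch_field"
  assumes "prime p" "vabs (of_nat p :: 'a) = 1 / real p" "vabs (1 - q) < 1" "x \<in> Zp"
  shows "qnum q (x + of_nat m) ^ n =
    (\<Sum>l=0..n. (of_nat (n choose l) * (-1) ^ l * padic_pow q (of_nat l * x) / (1 - q) ^ n) * (q ^ l) ^ m)"
proof -
  let ?u = "padic_pow q x * q ^ m"
  have "(1 - ?u) ^ n = (\<Sum>l=0..n. of_nat (n choose l) * (- ?u) ^ l)"
    using binomial_ring[of "- ?u" 1 n] by (simp add: atLeast0AtMost)
  also have "\<dots> = (\<Sum>l=0..n. of_nat (n choose l) * (-1) ^ l * padic_pow q (of_nat l * x) * (q ^ l) ^ m)"
    unfolding padic_pow_of_nat_mult[OF assms]
    by (intro sum.cong refl, subst power_minus)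
       (simp add: power_mult_distrib mult_ac flip: power_mult)
  finally show ?thesis
    by (simp add: qnum_def padic_pow_add_of_nat[OF assms] power_divide sum_divide_distrib)
qed

text \<open>The i-th variable collects \<open>w\<close> from the twist, \<open>q ^ l\<close> from
  the binomial expansion and \<open>q ^ (r - i)\<close> from the weight.\<close>

lemma twisted_qEuler_integrand:
  fixes q w x :: "'a::complete_nonarch_field" and k :: "nat \<Rightarrow> nat"
  assumes p: "prime p" "vabs (of_nat p :: 'a) = 1 / real p"
    and q: "vabs (1 - q) < 1" and w: "vabs (1 - w) < 1" and x: "x \<in> Zp"
  shows "padic_pow w (\<Sum>i=1..r. of_nat (k i)) * qnum q (x + (\<Sum>i=1..r. of_nat (k i))) ^ n *
      padic_pow q (\<Sum>i=1..r. of_nat (r - i) * of_nat (k i)) =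
    (\<Sum>l=0..n. (of_nat (n choose l) * (-1) ^ l * padic_pow q (of_nat l * x) / (1 - q) ^ n) *
      (\<Prod>i=1..r. (w * q ^ (l + (r - i))) ^ k i))"
proof -
  let ?K = "\<Sum>i=1..r. k i"
  have K: "(\<Sum>i=1..r. of_nat (k i)) = (of_nat ?K :: 'a)" by simp
  have "(\<Sum>i=1..r. of_nat (r - i) * of_nat (k i)) = (of_nat (\<Sum>i=1..r. (r - i) * k i) :: 'a)"
    by simp
  moreover have "(\<Prod>i=1..r. (w * q ^ (l + (r - i))) ^ k i) =
      w ^ ?K * (q ^ l) ^ ?K * q ^ (\<Sum>i=1..r. (r - i) * k i)" for l
    unfolding power_sum prod.distrib[symmetric]
    by (intro prod.cong refl) (simp only: power_mult_distrib power_add power_mult mult.assoc)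
  ultimately show ?thesis
    unfolding K qnum_power_expand[OF p q x]
    by (simp only: padic_pow_of_nat[OF p q] padic_pow_of_nat[OF p w] sum_distrib_left
        sum_distrib_right mult_ac)
qed

text \<open>Each factor is 1 plus \<open>q ^ l * w * q ^ j\<close>, an element at distance less than
  1 from 1.\<close>

lemma qpoch_minus_nonzero:
  fixes q w :: "'a::complete_nonarch_field"
  assumes "prime p" "odd p" "vabs (of_nat p :: 'a) = 1 / real p"
    and "vabs (1 - q) < 1" "vabs (1 - w) < 1"
  shows "qpoch (- (q ^ l) * w) q r \<noteq> 0"
  using one_plus_nonzero[OF assms(1-3)]
    vabs_one_minus_mult_less[OF vabs_one_minus_mult_less[OF
      vabs_one_minus_power_less[OF assms(4)] assms(5)] vabs_one_minus_power_less[OF assms(4)]]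
  by (simp add: qpoch_def)

lemma twisted_qEuler_closed_form:
  fixes q w x :: "'a::complete_nonarch_field"
  assumes p: "prime p" "odd p" "vabs (of_nat p :: 'a) = 1 / real p"
    and q: "vabs (1 - q) < 1" and w: "vabs (1 - w) < 1" and x: "x \<in> Zp"
  shows "twisted_qEuler p r n w q x =
      2 ^ r / (1 - q) ^ n *
        (\<Sum>l=0..n. of_nat (n choose l) * (-1) ^ l * padic_pow q (of_nat l * x) /
          qpoch (- (q ^ l) * w) q r)"
proof -
  let ?c = "\<lambda>l. of_nat (n choose l) * (-1) ^ l * padic_pow q (of_nat l * x) / (1 - q) ^ n"
  have "twisted_qEuler p r n w q x =
      (\<Sum>l=0..n. ?c l * (\<Prod>i=1..r. 2 / (1 + w * q ^ (l + (r - i)))))"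
    unfolding twisted_qEuler_def
    by (intro fermionic_integral_iter_exponential_sum p q w
        twisted_qEuler_integrand[OF p(1,3) q w x] vabs_one_minus_mult_less vabs_one_minus_power_less)
  also have "\<dots> = (\<Sum>l=0..n. 2 ^ r / (1 - q) ^ n *
      (of_nat (n choose l) * (-1) ^ l * padic_pow q (of_nat l * x) / qpoch (- (q ^ l) * w) q r))"
  proof (rule sum.cong)
    fix l
    \<comment> \<open>Shifting and then reversing the index turns the exponents
      \<open>l + (r - i)\<close> into the \<open>l + j\<close> of \<open>qpoch\<close>.\<close>
    have "(\<Prod>i=1..r. 2 / (1 + w * q ^ (l + (r - i)))) =
        (\<Prod>j<r. 2 / (1 + w * q ^ (l + (r - Suc j))))"
      by (simp add: prod.atLeast1_atMost_eq)
    also have "\<dots> = (\<Prod>j<r. 2 / (1 + w * q ^ (l + j)))"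
      by (rule prod.nat_diff_reindex)
    also have "\<dots> = 2 ^ r / qpoch (- (q ^ l) * w) q r"
      by (simp add: qpoch_def prod_dividef power_add mult_ac)
    finally show "?c l * (\<Prod>i=1..r. 2 / (1 + w * q ^ (l + (r - i)))) = 2 ^ r / (1 - q) ^ n *
        (of_nat (n choose l) * (-1) ^ l * padic_pow q (of_nat l * x) / qpoch (- (q ^ l) * w) q r)"
      by simp
  qed simp
  finally show ?thesis by (simp only: sum_distrib_left)
qed

lemma twisted_qEuler_power_series_sums:
  fixes q w x :: "'a::complete_nonarch_field"
  assumes p: "prime p" "odd p" "vabs (of_nat p :: 'a) = 1 / real p"
    and q: "vabs (1 - q) < 1" "q \<noteq> 1" "\<And>k. k \<ge> 1 \<Longrightarrow> q ^ k \<noteq> 1"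
    and w: "vabs (1 - w) < 1" and x: "x \<in> Zp" and r: "r \<ge> 1"
  shows "power_series_sums
      (\<lambda>m. qbinom q (m + r - 1) m * (-1) ^ m * qnum q (of_nat m + x) ^ n) w
      (1 / (1 - q) ^ n *
        (\<Sum>l=0..n. of_nat (n choose l) * (-1) ^ l * padic_pow q (of_nat l * x) /
          qpoch (- (q ^ l) * w) q r))"
proof -
  let ?c = "\<lambda>l. of_nat (n choose l) * (-1) ^ l * padic_pow q (of_nat l * x) / (1 - q) ^ n"
  let ?b = "\<lambda>m. \<Prod>i<m. (1 - q ^ (r + i)) / (1 - q ^ Suc i)"
  \<comment> \<open>The sign \<open>(-1) ^ m\<close> joins \<open>(q ^ l) ^ m\<close>, so the
    q-binomial series is used with \<open>a = - (q ^ l)\<close>.\<close>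
  have "qbinom q (m + r - 1) m * (-1) ^ m * qnum q (of_nat m + x) ^ n =
      (\<Sum>l=0..n. ?c l * (?b m * (- (q ^ l)) ^ m))" for m
    unfolding qbinom_eq_prod[OF p(1,3) q(1,2) r] add.commute[of "of_nat m"]
      qnum_power_expand[OF p(1,3) q(1) x] power_minus[of "q ^ _"] sum_distrib_left
    by (intro sum.cong refl) (simp only: mult_ac)
  moreover have "power_series_sums (\<lambda>m. \<Sum>l=0..n. ?c l * (?b m * (- (q ^ l)) ^ m)) w
      (\<Sum>l=0..n. ?c l * (1 / qpoch (- (q ^ l) * w) q r))"
    by (intro power_series_sums_sum power_series_sums_cmult power_series_sums_q_binomial q(3)
        qpoch_minus_nonzero[OF p q(1) w])
  ultimately show ?thesis by (simp add: sum_distrib_left)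
qed

text \<open>The second equality is conditional on nonzero q-factorials: if \<open>q\<close> is a
  root of unity, some q-binomial coefficients have denominator 0.\<close>

theorem theorem9:
  fixes p r n :: nat and q w x :: "'a::complete_nonarch_field"
  assumes "prime p" and "odd p" and "is_Cp p TYPE('a)"
    and "vabs (1 - q) < 1" and "q \<noteq> 1" and "vabs (1 - w) < 1"
    and "r \<ge> 1" and "x \<in> Zp"
  shows "twisted_qEuler p r n w q x =
      2 ^ r / (1 - q) ^ n *
        (\<Sum>l=0..n. of_nat (n choose l) * (-1) ^ l * padic_pow q (of_nat l * x) /
          qpoch (- (q ^ l) * w) q r)
    \<and> ((\<forall>k\<ge>1. qfact q k \<noteq> 0) \<longrightarrow>
        power_series_summable
          (\<lambda>m. qbinom q (m + r - 1) m * (-1) ^ m * qnum q (of_nat m + x) ^ n) w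
      \<and> twisted_qEuler p r n w q x =
        2 ^ r * power_series_sum
          (\<lambda>m. qbinom q (m + r - 1) m * (-1) ^ m * qnum q (of_nat m + x) ^ n) w)"
proof -
  have p: "vabs (of_nat p :: 'a) = 1 / real p"
    using assms(3) by (simp add: is_Cp_def)
  note closed = twisted_qEuler_closed_form[OF assms(1,2) p assms(4,6,8), of r n]
  have "power_series_summable
          (\<lambda>m. qbinom q (m + r - 1) m * (-1) ^ m * qnum q (of_nat m + x) ^ n) w
      \<and> twisted_qEuler p r n w q x =
        2 ^ r * power_series_sum
          (\<lambda>m. qbinom q (m + r - 1) m * (-1) ^ m * qnum q (of_nat m + x) ^ n) w"
    if qf: "\<forall>k\<ge>1. qfact q k \<noteq> 0"
  proof -
    \<comment> \<open>If \<open>q ^ k = 1\<close>, the factor \<open>qnum q k\<close> would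
      annihilate \<open>qfact q k\<close>.\<close>
    have "q ^ k \<noteq> 1" if "k \<ge> 1" for k
    proof
      assume "q ^ k = 1"
      then have "qnum q (of_nat k) = 0"
        by (simp add: qnum_of_nat[OF assms(1) p assms(4)])
      then have "qfact q k = 0"
        unfolding qfact_def using \<open>k \<ge> 1\<close> by (intro prod_zero) (auto intro!: bexI[of _ k])
      then show False using qf \<open>k \<ge> 1\<close> by blast
    qed
    from twisted_qEuler_power_series_sums[OF assms(1,2) p assms(4,5) this assms(6,8,7), of n]
    show ?thesis
      unfolding closed power_series_summable_def by (auto simp: power_series_sum_eq)
  qed
  then show ?thesis using closed by blast
qed

end
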